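(* Let $m,p,q\ge 1$ and $n_1,\dots,n_m\ge 1$ be integers and, for $i=1,\dots,m$, let $X_i\in\mathbb{R}^{n_i\times p}$, $Z_i\in\mathbb{R}^{n_i\times q}$, $Y_i\in\mathbb{R}^{n_i}$ and $\Lambda_i\in\mathbb{S}^{n_i}_{++}$. For $\beta\in\mathbb{R}^p$ and $\Gamma\in\mathbb{S}^q_+$ set $\Omega_i(\Gamma):=Z_i\Gamma Z_i^T+\Lambda_i$ and $$\mathcal{L}_{ML}(\beta,\Gamma):=\sum_{i=1}^m \tfrac12 (Y_i-X_i\beta)^T\Omega_i(\Gamma)^{-1}(Y_i-X_i\beta)+\tfrac12\ln\det\Omega_i(\Gamma).$$ Then the optimization problem $\min\{\mathcal{L}_{ML}(\beta,\Gamma) : \beta\in\mathbb{R}^p,\ \Gamma\in\mathbb{S}^q_+\}$ has an optimal solution, i.e. the infimum is attained at some $(\bar\beta,\bar\Gamma)\in\mathbb{R}^p\times\mathbb{S}^q_+$.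
   Context: $\mathbb{S}^k_+$ and $\mathbb{S}^k_{++}$ denote the sets of real symmetric $k\times k$ positive semidefinite and positive definite matrices, respectively. *)

theory Defs
  imports
    Complex_Main
    "Jordan_Normal_Form.Determinant"
    "Jordan_Normal_Form.Gauss_Jordan_Elimination"
begin

definition psd_mats :: "nat \<Rightarrow> real mat set" where
  "psd_mats k = {A \<in> carrier_mat k k. transpose_mat A = A \<and>
     (\<forall>x \<in> carrier_vec k. x \<bullet> (A *\<^sub>v x) \<ge> 0)}"

definition pd_mats :: "nat \<Rightarrow> real mat set" where
  "pd_mats k = {A \<in> carrier_mat k k. transpose_mat A = A \<and>
     (\<forall>x \<in> carrier_vec k. x \<noteq> 0\<^sub>v k \<longrightarrow> x \<bullet> (A *\<^sub>v x) > 0)}"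

definition Omega :: "real mat \<Rightarrow> real mat \<Rightarrow> real mat \<Rightarrow> real mat" where
  "Omega Z \<Lambda> \<Gamma> = Z * \<Gamma> * transpose_mat Z + \<Lambda>"

text \<open>In \<open>L_ML\<close>, \<open>the (mat_inverse _)\<close> is the genuine inverse whenever \<open>\<Lambda> i\<close> is positive
  definite and \<open>\<Gamma>\<close> is positive semidefinite, since \<open>Omega\<close> is then positive definite;
  for the same reason its determinant is positive and \<open>ln\<close> is applied inside its domain.\<close>

definition L_ML :: "nat \<Rightarrow> (nat \<Rightarrow> real mat) \<Rightarrow> (nat \<Rightarrow> real mat) \<Rightarrow> (nat \<Rightarrow> real vec) \<Rightarrow>
    (nat \<Rightarrow> real mat) \<Rightarrow> real vec \<Rightarrow> real mat \<Rightarrow> real" where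
  "L_ML m X Z Y \<Lambda> \<beta> \<Gamma> =
    (\<Sum>i<m.
      (1 / 2) * ((Y i - X i *\<^sub>v \<beta>) \<bullet>
        (the (mat_inverse (Omega (Z i) (\<Lambda> i) \<Gamma>)) *\<^sub>v (Y i - X i *\<^sub>v \<beta>)))
      + (1 / 2) * ln (det (Omega (Z i) (\<Lambda> i) \<Gamma>)))"

end

theory Submission
  imports Defs
begin

text \<open>A minimizing sequence need not be bounded, because \<open>\<beta>\<close> and \<open>\<Gamma>\<close> enter the objective only through
  \<open>X\<^sub>i \<beta>\<close> and \<open>Z\<^sub>i \<Gamma> Z\<^sub>i\<^sup>T\<close>. On a sublevel set these quantities are bounded: the growth estimate
  \<open>det (\<Lambda> + A) \<ge> det \<Lambda> (1 + A\<^sub>j\<^sub>j / \<Lambda>\<^sub>j\<^sub>j)\<close> for positive semidefinite \<open>A\<close> bounds the diagonal of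
  \<open>Z\<^sub>i \<Gamma> Z\<^sub>i\<^sup>T\<close>, and \<open>r\<^sub>j\<^sup>2 \<le> \<Omega>\<^sub>j\<^sub>j (r \<bullet> \<Omega>\<inverse> r)\<close> (Cauchy--Schwarz) then bounds the residuals. With a
  generalized inverse \<open>M\<close> of the stacked matrix \<open>Z\<close>, replacing \<open>\<Gamma>\<close> by \<open>(M Z) \<Gamma> (M Z)\<^sup>T\<close> leaves the
  objective unchanged and bounds \<open>\<Gamma>\<close>; likewise for \<open>\<beta>\<close>. So some minimizing sequence is bounded, and a
  convergent subsequence yields the minimizer by continuity.\<close>

section \<open>Positive semidefinite matrices\<close>

lemma bilinear_form_sum:
  assumes "A \<in> carrier_mat n n" "x \<in> carrier_vec n" "y \<in> carrier_vec n"
  shows "x \<bullet> (A *\<^sub>v y) = (\<Sum>i<n. \<Sum>j<n. x $ i * A $$ (i, j) * y $ j)"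
  using assms by (auto simp: scalar_prod_def sum_distrib_left mult.assoc lessThan_atLeast0 intro!: sum.cong)

lemma psd_matsD:
  assumes "A \<in> psd_mats n"
  shows "A \<in> carrier_mat n n" "transpose_mat A = A"
    "x \<in> carrier_vec n \<Longrightarrow> 0 \<le> x \<bullet> (A *\<^sub>v x)"
  using assms by (auto simp: psd_mats_def)

lemma pd_matsD:
  assumes "A \<in> pd_mats n"
  shows "A \<in> carrier_mat n n" "transpose_mat A = A"
    "x \<in> carrier_vec n \<Longrightarrow> x \<noteq> 0\<^sub>v n \<Longrightarrow> 0 < x \<bullet> (A *\<^sub>v x)"
  using assms by (auto simp: pd_mats_def)

lemma pd_mats_subset_psd_mats: "pd_mats n \<subseteq> psd_mats n"
proof
  fix A assume A: "A \<in> pd_mats n"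
  have "0 \<le> x \<bullet> (A *\<^sub>v x)" if "x \<in> carrier_vec n" for x
    using pd_matsD[OF A] that by (cases "x = 0\<^sub>v n") (auto simp: less_imp_le)
  then show "A \<in> psd_mats n"
    using pd_matsD[OF A] by (simp add: psd_mats_def)
qed

lemma zero_mem_psd_mats: "0\<^sub>m n n \<in> psd_mats n"
  by (auto simp: psd_mats_def scalar_prod_def)

lemma pd_add_psd:
  assumes "A \<in> pd_mats n" "B \<in> psd_mats n"
  shows "A + B \<in> pd_mats n"
proof -
  have "0 < x \<bullet> ((A + B) *\<^sub>v x)" if x: "x \<in> carrier_vec n" "x \<noteq> 0\<^sub>v n" for x
    using pd_matsD[OF assms(1)] psd_matsD[OF assms(2)] x
    by (auto simp: add_mult_distrib_mat_vec[of _ n n] scalar_prod_add_distrib[of _ n] intro!: add_pos_nonneg)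
  then show ?thesis
    using pd_matsD[OF assms(1)] psd_matsD[OF assms(2)] by (simp add: pd_mats_def transpose_add[of _ n n])
qed

lemma congruence_mem_psd_mats:
  assumes "Z \<in> carrier_mat n q" "G \<in> psd_mats q"
  shows "Z * G * transpose_mat Z \<in> psd_mats n"
proof -
  note G = psd_matsD[OF assms(2)]
  note Z = assms(1)
  have "0 \<le> x \<bullet> (Z * G * transpose_mat Z *\<^sub>v x)" if x: "x \<in> carrier_vec n" for x
  proof -
    have "x \<bullet> (Z * G * transpose_mat Z *\<^sub>v x) = x \<bullet> (Z *\<^sub>v (G *\<^sub>v (transpose_mat Z *\<^sub>v x)))"
      using Z G(1) x by (simp add: assoc_mult_mat_vec[of _ n q _ n] assoc_mult_mat_vec[of _ n q _ q])
    also have "\<dots> = (transpose_mat Z *\<^sub>v x) \<bullet> (G *\<^sub>v (transpose_mat Z *\<^sub>v x))"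
      using Z G(1) x by (subst transpose_vec_mult_scalar[of Z n q]) auto
    also have "\<dots> \<ge> 0"
      using G(3) Z x by simp
    finally show ?thesis .
  qed
  moreover have "transpose_mat (Z * G * transpose_mat Z) = Z * G * transpose_mat Z"
    using Z G(1,2) by (simp add: transpose_mult[of _ n q _ n] transpose_mult[of _ q q _ n])
  ultimately show ?thesis
    using Z G(1) by (simp add: psd_mats_def)
qed

lemma symmetric_form_commute:
  fixes A :: "real mat"
  assumes "A \<in> carrier_mat n n" "transpose_mat A = A" "x \<in> carrier_vec n" "y \<in> carrier_vec n"
  shows "x \<bullet> (A *\<^sub>v y) = y \<bullet> (A *\<^sub>v x)"
  using transpose_vec_mult_scalar[of A n n y x] assms
  by (simp add: comm_scalar_prod[of _ n])

text \<open>The quadratic a + 2tb + t^2 c is the form at x + ty, hence nonnegative for every real t.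
  If c > 0, its minimizer t = -b/c gives the claim. Since \<open>A\<close> is only semidefinite, c =
  0 can occur for nonzero y; the quadratic is then affine in t, which forces b = 0.\<close>

lemma psd_Cauchy_Schwarz:
  assumes A: "A \<in> psd_mats n" and x: "x \<in> carrier_vec n" and y: "y \<in> carrier_vec n"
  shows "(x \<bullet> (A *\<^sub>v y))\<^sup>2 \<le> (x \<bullet> (A *\<^sub>v x)) * (y \<bullet> (A *\<^sub>v y))"
proof -
  define a b c where "a = x \<bullet> (A *\<^sub>v x)" and "b = x \<bullet> (A *\<^sub>v y)" and "c = y \<bullet> (A *\<^sub>v y)"
  note A' = psd_matsD[OF A]
  have nn: "0 \<le> a + 2 * t * b + t\<^sup>2 * c" for t
  proof -
    have "0 \<le> (x + t \<cdot>\<^sub>v y) \<bullet> (A *\<^sub>v (x + t \<cdot>\<^sub>v y))"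
      using x y by (intro A'(3)) auto
    also have "\<dots> = a + 2 * t * b + t\<^sup>2 * c"
      using A'(1) x y symmetric_form_commute[OF A'(1,2) y x]
      by (simp add: a_def b_def c_def mult_add_distrib_mat_vec[of _ n n] mult_mat_vec[of _ n n]
          scalar_prod_add_distrib[of _ n] add_scalar_prod_distrib[of _ n]
          algebra_simps power2_eq_square)
    finally show ?thesis .
  qed
  have "0 \<le> c"
    unfolding c_def by (rule A'(3)[OF y])
  have "b\<^sup>2 \<le> a * c"
  proof (cases "c = 0")
    case True
    have "b = 0"
    proof (rule ccontr)
      assume "b \<noteq> 0"
      \<comment> \<open>This t solves a + 2tb = -1, a negative value.\<close>
      with nn[of "- (a + 1) / (2 * b)"] True show False
        by (simp add: field_simps)
    qed
    with True show ?thesis by simp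
  next
    case False
    with \<open>0 \<le> c\<close> have "c > 0" by simp
    have "0 \<le> a + 2 * (- b / c) * b + (- b / c)\<^sup>2 * c"
      by (rule nn)
    also have "\<dots> = a - b\<^sup>2 / c"
      using \<open>c > 0\<close> by (simp add: field_simps power2_eq_square)
    finally show ?thesis
      using \<open>c > 0\<close> by (simp add: field_simps)
  qed
  then show ?thesis
    by (simp add: a_def b_def c_def)
qed

lemma mat_mult_unit_vec:
  fixes A :: "real mat"
  assumes "A \<in> carrier_mat n n" "j < n"
  shows "A *\<^sub>v unit_vec n j = col A j"
  using assms by (intro eq_vecI) auto

lemma unit_vec_form:
  fixes A :: "real mat"
  assumes "A \<in> carrier_mat n n" "i < n" "j < n"
  shows "unit_vec n i \<bullet> (A *\<^sub>v unit_vec n j) = A $$ (i, j)"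
  using assms by (simp add: mat_mult_unit_vec)

lemma psd_diag_nonneg: "A \<in> psd_mats n \<Longrightarrow> j < n \<Longrightarrow> 0 \<le> A $$ (j, j)"
  using psd_matsD(3)[of A n "unit_vec n j"] psd_matsD(1)[of A n] by (simp add: unit_vec_form)

lemma pd_diag_pos: "A \<in> pd_mats n \<Longrightarrow> j < n \<Longrightarrow> 0 < A $$ (j, j)"
  using pd_matsD(3)[of A n "unit_vec n j"] pd_matsD(1)[of A n] by (simp add: unit_vec_form)

text \<open>Cauchy-Schwarz on two unit vectors. Its main consequence: a zero diagonal entry
  annihilates its whole row and column.\<close>

lemma psd_entry_sq_le:
  assumes "A \<in> psd_mats n" "i < n" "j < n"
  shows "(A $$ (i, j))\<^sup>2 \<le> A $$ (i, i) * A $$ (j, j)"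
  using psd_Cauchy_Schwarz[OF assms(1), of "unit_vec n i" "unit_vec n j"] assms psd_matsD(1)[OF assms(1)]
  by (simp add: unit_vec_form)

section \<open>Entrywise convergence\<close>

abbreviation inv_mat :: "real mat \<Rightarrow> real mat" where
  "inv_mat A \<equiv> the (mat_inverse A)"

text \<open>The dimensions belong to the matrix itself, so they are fixed for every index k rather
  than eventually along \<open>F\<close>; what remains of convergence is a finite set of real
  limits.\<close>

definition mat_tendsto :: "nat \<Rightarrow> nat \<Rightarrow> ('k \<Rightarrow> real mat) \<Rightarrow> real mat \<Rightarrow> 'k filter \<Rightarrow> bool" where
  "mat_tendsto n m A L F \<longleftrightarrow> (\<forall>k. A k \<in> carrier_mat n m) \<and> L \<in> carrier_mat n m \<and>
     (\<forall>i<n. \<forall>j<m. ((\<lambda>k. A k $$ (i, j)) \<longlongrightarrow> L $$ (i, j)) F)"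

definition vec_tendsto :: "nat \<Rightarrow> ('k \<Rightarrow> real Matrix.vec) \<Rightarrow> real Matrix.vec \<Rightarrow> 'k filter \<Rightarrow> bool" where
  "vec_tendsto n v l F \<longleftrightarrow> (\<forall>k. v k \<in> carrier_vec n) \<and> l \<in> carrier_vec n \<and>
     (\<forall>i<n. ((\<lambda>k. v k $ i) \<longlongrightarrow> l $ i) F)"

lemma mat_tendsto_const: "A \<in> carrier_mat n m \<Longrightarrow> mat_tendsto n m (\<lambda>k. A) A F"
  by (simp add: mat_tendsto_def)

lemma vec_tendsto_const: "v \<in> carrier_vec n \<Longrightarrow> vec_tendsto n (\<lambda>k. v) v F"
  by (simp add: vec_tendsto_def)

lemma mat_tendsto_add:
  assumes "mat_tendsto n m A L F" "mat_tendsto n m B K F"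
  shows "mat_tendsto n m (\<lambda>k. A k + B k) (L + K) F"
proof -
  have "(A k + B k) $$ (i, j) = A k $$ (i, j) + B k $$ (i, j)" if "i < n" "j < m" for k i j
    using assms that by (simp add: mat_tendsto_def carrier_matD[of _ n m])
  then show ?thesis
    using assms by (auto simp: mat_tendsto_def intro!: tendsto_add)
qed

lemma mat_tendsto_mult:
  assumes "mat_tendsto n m A L F" "mat_tendsto m l B K F"
  shows "mat_tendsto n l (\<lambda>k. A k * B k) (L * K) F"
proof -
  have "(A k * B k) $$ (i, j) = (\<Sum>h<m. A k $$ (i, h) * B k $$ (h, j))" if "i < n" "j < l" for k i j
    using assms that
    by (simp add: mat_tendsto_def scalar_prod_def lessThan_atLeast0 carrier_matD[of _ n m] carrier_matD[of _ m l])
  moreover have "(L * K) $$ (i, j) = (\<Sum>h<m. L $$ (i, h) * K $$ (h, j))" if "i < n" "j < l" for i j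
    using assms that by (auto simp: mat_tendsto_def scalar_prod_def lessThan_atLeast0)
  ultimately show ?thesis
    using assms by (auto simp: mat_tendsto_def intro!: tendsto_sum tendsto_mult intro: mult_carrier_mat)
qed

lemma mat_tendsto_mult_vec:
  assumes "mat_tendsto n m A L F" "vec_tendsto m v w F"
  shows "vec_tendsto n (\<lambda>k. A k *\<^sub>v v k) (L *\<^sub>v w) F"
proof -
  have "(A k *\<^sub>v v k) $ i = (\<Sum>h<m. A k $$ (i, h) * v k $ h)" if "i < n" for k i
    using assms that
    by (simp add: mat_tendsto_def vec_tendsto_def scalar_prod_def lessThan_atLeast0
        carrier_matD[of _ n m] carrier_vecD[of _ m])
  moreover have "(L *\<^sub>v w) $ i = (\<Sum>h<m. L $$ (i, h) * w $ h)" if "i < n" for i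
    using assms that by (auto simp: mat_tendsto_def vec_tendsto_def scalar_prod_def lessThan_atLeast0)
  ultimately show ?thesis
    using assms
    by (auto simp: mat_tendsto_def vec_tendsto_def intro!: tendsto_sum tendsto_mult intro: mult_mat_vec_carrier)
qed

lemma vec_tendsto_diff:
  assumes "vec_tendsto n u a F" "vec_tendsto n v b F"
  shows "vec_tendsto n (\<lambda>k. u k - v k) (a - b) F"
proof -
  have "(u k - v k) $ i = u k $ i - v k $ i" if "i < n" for k i
    using assms that by (simp add: vec_tendsto_def carrier_vecD[of _ n])
  then show ?thesis
    using assms by (auto simp: vec_tendsto_def intro!: tendsto_diff)
qed

lemma tendsto_scalar_prod:
  assumes "vec_tendsto n u a F" "vec_tendsto n v b F"
  shows "((\<lambda>k. u k \<bullet> v k) \<longlongrightarrow> a \<bullet> b) F"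
proof -
  have "u k \<bullet> v k = (\<Sum>i<n. u k $ i * v k $ i)" for k
    using assms by (simp add: vec_tendsto_def scalar_prod_def lessThan_atLeast0 carrier_vecD[of _ n])
  moreover have "a \<bullet> b = (\<Sum>i<n. a $ i * b $ i)"
    using assms by (auto simp: vec_tendsto_def scalar_prod_def lessThan_atLeast0)
  ultimately show ?thesis
    using assms by (auto simp: vec_tendsto_def intro!: tendsto_sum tendsto_mult)
qed

text \<open>By the Leibniz formula the determinant is a polynomial in the entries.\<close>

lemma tendsto_det:
  assumes "mat_tendsto n n A L F"
  shows "((\<lambda>k. det (A k)) \<longlongrightarrow> det L) F"
proof -
  have "det (A k) = (\<Sum>p | p permutes {0..<n}. signof p * (\<Prod>i = 0..<n. A k $$ (i, p i)))" for k
    using assms by (intro det_def') (auto simp: mat_tendsto_def)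
  moreover have "det L = (\<Sum>p | p permutes {0..<n}. signof p * (\<Prod>i = 0..<n. L $$ (i, p i)))"
    using assms by (intro det_def') (auto simp: mat_tendsto_def)
  moreover have "((\<lambda>k. A k $$ (i, p i)) \<longlongrightarrow> L $$ (i, p i)) F" if "p permutes {0..<n}" "i \<in> {0..<n}" for p i
    using assms that permutes_in_image[OF that(1), of i] by (auto simp: mat_tendsto_def)
  ultimately show ?thesis
    by (auto intro!: tendsto_sum tendsto_mult tendsto_prod)
qed

lemma mat_tendsto_mat_delete:
  assumes "mat_tendsto n n A L F" "i < n" "j < n"
  shows "mat_tendsto (n - 1) (n - 1) (\<lambda>k. mat_delete (A k) i j) (mat_delete L i j) F"
proof -
  have "((\<lambda>k. mat_delete (A k) i j $$ (a, b)) \<longlongrightarrow> mat_delete L i j $$ (a, b)) F"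
    if "a < n - 1" "b < n - 1" for a b
  proof -
    have "mat_delete M i j $$ (a, b) = M $$ (if a < i then a else Suc a, if b < j then b else Suc b)"
      if "M \<in> carrier_mat n n" for M :: "real mat"
      using that \<open>a < n - 1\<close> \<open>b < n - 1\<close> by (auto simp: mat_delete_def)
    then show ?thesis
      using assms that by (auto simp: mat_tendsto_def)
  qed
  moreover have "mat_delete M i j \<in> carrier_mat (n - 1) (n - 1)" if "M \<in> carrier_mat n n" for M :: "real mat"
    using that by (rule mat_delete_carrier)
  ultimately show ?thesis
    using assms unfolding mat_tendsto_def by blast
qed

text \<open>Cofactors are signed determinants of minors, so they too are polynomials in the entries.
  Continuity of the inverse is later obtained by dividing the adjugate by the determinant.\<close>

lemma mat_tendsto_adj_mat:
  assumes "mat_tendsto n n A L F"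
  shows "mat_tendsto n n (\<lambda>k. adj_mat (A k)) (adj_mat L) F"
proof -
  have "adj_mat M $$ (i, j) = (- 1) ^ (j + i) * det (mat_delete M j i)"
    if "M \<in> carrier_mat n n" "i < n" "j < n" for M :: "real mat" and i j
    using that by (auto simp: adj_mat_def cofactor_def)
  then show ?thesis
    using assms adj_mat(1)[of "A _" n]
    by (auto simp: mat_tendsto_def intro!: adj_mat(1) tendsto_mult tendsto_det[OF mat_tendsto_mat_delete[OF assms]])
qed

section \<open>Positive definite matrices: determinant and inverse\<close>

lemma scalar_prod_self_pos:
  fixes v :: "real Matrix.vec"
  assumes "v \<in> carrier_vec n" "v \<noteq> 0\<^sub>v n"
  shows "0 < v \<bullet> v"
proof -
  obtain i where "i < n" "v $ i \<noteq> 0"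
    using assms by (metis carrier_vecD eq_vecI index_zero_vec(1,2))
  then have "0 < (\<Sum>i\<in>{0..<n}. v $ i * v $ i)"
    by (intro sum_pos2[of _ i]) (auto simp: zero_less_mult_iff)
  then show ?thesis
    using assms by (simp add: scalar_prod_def)
qed

lemma pd_det_nonzero:
  assumes "A \<in> pd_mats n"
  shows "det A \<noteq> 0"
proof
  assume "det A = 0"
  then obtain v where v: "v \<in> carrier_vec n" "v \<noteq> 0\<^sub>v n" "A *\<^sub>v v = 0\<^sub>v n"
    using det_0_iff_vec_prod_zero[OF pd_matsD(1)[OF assms]] by auto
  from pd_matsD(3)[OF assms v(1,2)] v show False by simp
qed

lemma smult_mat_mult_vec:
  fixes B :: "real mat"
  assumes "B \<in> carrier_mat n n" "v \<in> carrier_vec n"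
  shows "(c \<cdot>\<^sub>m B) *\<^sub>v v = c \<cdot>\<^sub>v (B *\<^sub>v v)"
  using assms by (intro eq_vecI) auto

text \<open>The segment \<open>M t\<close> from the identity to \<open>A\<close> consists of
  positive definite matrices. Its determinant starts at 1, so a nonpositive value at
  \<open>A\<close> would yield, by the intermediate value theorem, a singular \<open>M t\<close>; a
  kernel vector of it contradicts definiteness.\<close>

lemma pd_det_pos:
  assumes "A \<in> pd_mats n"
  shows "0 < det A"
proof (rule ccontr)
  assume neg: "\<not> 0 < det A"
  define M where "M t = t \<cdot>\<^sub>m A + (1 - t) \<cdot>\<^sub>m 1\<^sub>m n" for t
  note A = pd_matsD[OF assms]
  have Mc: "M t \<in> carrier_mat n n" for t
    using A(1) by (simp add: M_def)
  have "((\<lambda>s. M s $$ (i, j)) \<longlongrightarrow> M t $$ (i, j)) (at t)" if "i < n" "j < n" for t i j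
  proof -
    have "M s $$ (i, j) = s * A $$ (i, j) + (1 - s) * 1\<^sub>m n $$ (i, j)" for s
      using A(1) that by (simp add: M_def)
    then show ?thesis
      by (auto intro!: tendsto_intros)
  qed
  then have "mat_tendsto n n M (M t) (at t)" for t
    using Mc by (simp add: mat_tendsto_def)
  then have cont: "isCont (\<lambda>t. det (M t)) t" for t
    unfolding isCont_def by (rule tendsto_det)
  have M0: "M 0 = 1\<^sub>m n" and M1: "M 1 = A"
    using A(1) by (auto simp: M_def intro!: eq_matI)
  have "\<exists>t. 0 \<le> t \<and> t \<le> 1 \<and> det (M t) = 0"
    by (rule IVT2) (use neg M0 M1 cont in auto)
  then obtain t where t: "0 \<le> t" "t \<le> 1" "det (M t) = 0"
    by auto
  obtain v where v: "v \<in> carrier_vec n" "v \<noteq> 0\<^sub>v n" "M t *\<^sub>v v = 0\<^sub>v n"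
    using t det_0_iff_vec_prod_zero[OF Mc] by auto
  have "0 = v \<bullet> (M t *\<^sub>v v)"
    using v by simp
  also have "\<dots> = t * (v \<bullet> (A *\<^sub>v v)) + (1 - t) * (v \<bullet> v)"
    using v(1) A(1) by (simp add: M_def add_mult_distrib_mat_vec[of _ n n] smult_mat_mult_vec[of _ n] scalar_prod_add_distrib[of _ n])
  also have "\<dots> > 0"
    using t(1,2) A(3)[OF v(1,2)] scalar_prod_self_pos[OF v(1,2)]
    by (cases "t = 0") (auto intro!: add_pos_nonneg)
  finally show False by simp
qed

lemma pd_inverse:
  assumes "A \<in> pd_mats n"
  shows "inv_mat A \<in> carrier_mat n n" "A * inv_mat A = 1\<^sub>m n" "inv_mat A * A = 1\<^sub>m n"
    "inv_mat A = (1 / det A) \<cdot>\<^sub>m adj_mat A"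
proof -
  note A = pd_matsD(1)[OF assms]
  have "mat_inverse A \<noteq> None"
    \<comment> \<open>Both facts speak of the units of a matrix ring record with an arbitrary
      extension field; instantiating it by \<open>()\<close> on both sides makes them refer to the
      same ring.\<close>
    using mat_inverse(1)[OF A, of "()"] det_non_zero_imp_unit[OF A pd_det_nonzero[OF assms], of "()"] by blast
  then show B: "inv_mat A \<in> carrier_mat n n" "A * inv_mat A = 1\<^sub>m n" "inv_mat A * A = 1\<^sub>m n"
    using mat_inverse(2)[OF A] by auto
  have "adj_mat A = inv_mat A * A * adj_mat A"
    using B(3) adj_mat(1)[OF A] by simp
  also have "\<dots> = inv_mat A * (det A \<cdot>\<^sub>m 1\<^sub>m n)"
    using A B(1) adj_mat[OF A] by (simp add: assoc_mult_mat[of _ n n _ n _ n])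
  also have "\<dots> = det A \<cdot>\<^sub>m inv_mat A"
    using B(1) by (simp add: mult_smult_distrib[of _ n n _ n])
  finally show "inv_mat A = (1 / det A) \<cdot>\<^sub>m adj_mat A"
    using B(1) pd_det_nonzero[OF assms] by (auto intro!: eq_matI)
qed

text \<open>Put s = A^-1 r. The inverse form at r is then the form of \<open>A\<close> at s, and the
  j-th entry of r is the form of \<open>A\<close> between the j-th unit vector and s, so
  Cauchy-Schwarz for \<open>A\<close> gives the second claim.\<close>

lemma pd_inverse_form:
  assumes A: "A \<in> pd_mats n" and r: "r \<in> carrier_vec n"
  shows "0 \<le> r \<bullet> (inv_mat A *\<^sub>v r)"
    and "j < n \<Longrightarrow> (r $ j)\<^sup>2 \<le> A $$ (j, j) * (r \<bullet> (inv_mat A *\<^sub>v r))"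
proof -
  define s where "s = inv_mat A *\<^sub>v r"
  note B = pd_inverse[OF A]
  note A' = pd_matsD[OF A]
  have psd: "A \<in> psd_mats n"
    using A pd_mats_subset_psd_mats by auto
  have s: "s \<in> carrier_vec n"
    using B(1) r by (simp add: s_def)
  have As: "A *\<^sub>v s = r"
    using B A'(1) r by (simp add: s_def flip: assoc_mult_mat_vec)
  have form: "r \<bullet> (inv_mat A *\<^sub>v r) = s \<bullet> (A *\<^sub>v s)"
    using As s r by (simp add: comm_scalar_prod[of _ n] flip: s_def)
  show "0 \<le> r \<bullet> (inv_mat A *\<^sub>v r)"
    unfolding form by (rule psd_matsD(3)[OF psd s])
  assume j: "j < n"
  have "r $ j = unit_vec n j \<bullet> (A *\<^sub>v s)"
    using As j r by simp
  then show "(r $ j)\<^sup>2 \<le> A $$ (j, j) * (r \<bullet> (inv_mat A *\<^sub>v r))"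
    unfolding form using psd_Cauchy_Schwarz[OF psd unit_vec_carrier s, of j] A'(1) j
    by (simp add: unit_vec_form)
qed

section \<open>Rank-one updates and growth of the determinant\<close>

text \<open>The bordered matrix with blocks I, W, -V, 1 has two block triangular factorizations.
  Eliminating the lower left block leaves the 1x1 Schur complement \<open>c\<close>, whose
  determinant is 1 + v . w; eliminating the upper left coupling instead leaves I + WV.\<close>

lemma det_one_plus_rank_one:
  fixes w v :: "real Matrix.vec"
  assumes w: "w \<in> carrier_vec n" and v: "v \<in> carrier_vec n"
  shows "det (1\<^sub>m n + mat n n (\<lambda>(i, j). w $ i * v $ j)) = 1 + v \<bullet> w"
proof -
  define W V c where "W = mat n 1 (\<lambda>(i, j). w $ i)" and "V = mat 1 n (\<lambda>(i, j). v $ j)"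
    and "c = mat 1 1 (\<lambda>_. 1 + v \<bullet> w)"
  have carr: "W \<in> carrier_mat n 1" "V \<in> carrier_mat 1 n" "c \<in> carrier_mat 1 1"
    by (auto simp: W_def V_def c_def)
  have WV: "W * V = mat n n (\<lambda>(i, j). w $ i * v $ j)"
    by (intro eq_matI) (auto simp: W_def V_def scalar_prod_def)
  have VW: "V * W + c = (1 + 2 * (v \<bullet> w)) \<cdot>\<^sub>m 1\<^sub>m 1" "- V * W + c = 1\<^sub>m 1"
    using v w by (auto intro!: eq_matI simp: W_def V_def c_def scalar_prod_def sum_negf)
  have "det c = 1 + v \<bullet> w"
    by (simp add: c_def det_single)
  let ?M = "four_block_mat (1\<^sub>m n) W (- V) (1\<^sub>m 1)"
  let ?R = "1\<^sub>m n + W * V"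
  have "?M = four_block_mat (1\<^sub>m n) (0\<^sub>m n 1) (- V) (1\<^sub>m 1) * four_block_mat (1\<^sub>m n) W (0\<^sub>m 1 n) c"
    using carr VW by (subst mult_four_block_mat[of _ n n _ 1 _ 1 _ _ n _ 1]) auto
  then have "det ?M = det (four_block_mat (1\<^sub>m n) (0\<^sub>m n 1) (- V) (1\<^sub>m 1)) * det (four_block_mat (1\<^sub>m n) W (0\<^sub>m 1 n) c)"
    using carr by (metis det_mult four_block_carrier_mat one_carrier_mat)
  then have "det ?M = 1 + v \<bullet> w"
    using carr \<open>det c = 1 + v \<bullet> w\<close> by (simp add: det_four_block_mat_upper_right_zero[of _ n _ 1]
        det_four_block_mat_lower_left_zero[of _ n _ 1])
  moreover have "?M = four_block_mat ?R W (0\<^sub>m 1 n) (1\<^sub>m 1) * four_block_mat (1\<^sub>m n) (0\<^sub>m n 1) (- V) (1\<^sub>m 1)"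
  proof -
    have "?R + W * - V = 1\<^sub>m n"
      using carr by (intro eq_matI) (auto simp: scalar_prod_def)
    then show ?thesis
      using carr by (subst mult_four_block_mat[of _ n n _ 1 _ 1 _ _ n _ 1]) auto
  qed
  then have "det ?M = det (four_block_mat ?R W (0\<^sub>m 1 n) (1\<^sub>m 1)) * det (four_block_mat (1\<^sub>m n) (0\<^sub>m n 1) (- V) (1\<^sub>m 1))"
    using carr by (metis det_mult four_block_carrier_mat one_carrier_mat add_carrier_mat mult_carrier_mat)
  then have "det ?M = det ?R"
    using carr by (simp add: det_four_block_mat_upper_right_zero[of _ n _ 1]
        det_four_block_mat_lower_left_zero[of _ n _ 1])
  ultimately show ?thesis
    by (simp add: WV)
qed

definition outer :: "real Matrix.vec \<Rightarrow> real mat" where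
  "outer v = mat (dim_vec v) (dim_vec v) (\<lambda>(i, j). v $ i * v $ j)"

lemma outer_carrier: "v \<in> carrier_vec n \<Longrightarrow> outer v \<in> carrier_mat n n"
  by (auto simp: outer_def)

lemma outer_form:
  assumes "v \<in> carrier_vec n" "x \<in> carrier_vec n"
  shows "x \<bullet> (outer v *\<^sub>v x) = (x \<bullet> v)\<^sup>2"
  using assms by (simp add: bilinear_form_sum[OF outer_carrier[OF assms(1)]])
    (auto simp: outer_def scalar_prod_def power2_eq_square sum_product lessThan_atLeast0 mult_ac intro!: sum.cong)

lemma outer_mem_psd_mats: "v \<in> carrier_vec n \<Longrightarrow> outer v \<in> psd_mats n"
  by (auto simp: psd_mats_def outer_carrier outer_form) (auto simp: outer_def intro!: eq_matI)

text \<open>With w = A^-1 v, the update factors as A + v v^T = A (I + w v^T), which reduces the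
  claim to a rank-one update of the identity.\<close>

lemma det_add_outer:
  assumes A: "A \<in> pd_mats n" and v: "v \<in> carrier_vec n"
  shows "det (A + outer v) = det A * (1 + v \<bullet> (inv_mat A *\<^sub>v v))"
proof -
  define w where "w = inv_mat A *\<^sub>v v"
  note A' = pd_matsD(1)[OF A]
  note B = pd_inverse[OF A]
  have w: "w \<in> carrier_vec n"
    using B(1) v by (simp add: w_def)
  have Aw: "A *\<^sub>v w = v"
    using B A' v by (simp add: w_def flip: assoc_mult_mat_vec)
  have "A * (1\<^sub>m n + mat n n (\<lambda>(i, j). w $ i * v $ j)) = A + outer v"
  proof -
    have "(A * mat n n (\<lambda>(i, j). w $ i * v $ j)) $$ (i, j) = outer v $$ (i, j)" if "i < n" "j < n" for i j
    proof -
      have "(A * mat n n (\<lambda>(i, j). w $ i * v $ j)) $$ (i, j) = (A *\<^sub>v w) $ i * v $ j"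
        using that A' w by (simp add: scalar_prod_def sum_distrib_right mult.assoc)
      also have "\<dots> = outer v $$ (i, j)"
        using that v by (simp add: Aw outer_def)
      finally show ?thesis .
    qed
    then have "A * mat n n (\<lambda>(i, j). w $ i * v $ j) = outer v"
      using A' outer_carrier[OF v] by (intro eq_matI) auto
    then show ?thesis
      using A' by (simp add: mult_add_distrib_mat[of _ n n _ n])
  qed
  then have "det (A + outer v) = det A * det (1\<^sub>m n + mat n n (\<lambda>(i, j). w $ i * v $ j))"
    using A' by (metis det_mult add_carrier_mat mat_carrier)
  then show ?thesis
    using det_one_plus_rank_one[OF w v] by (simp add: w_def)
qed

text \<open>One step of an outer-product Cholesky factorization: \<open>v\<close> is the scaled j-th
  column. Cauchy-Schwarz between x and the j-th unit vector bounds (x . v)^2 by the form of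
  \<open>A\<close> at x, so the remainder stays positive semidefinite. If the i-th diagonal entry of
  \<open>A\<close> is zero, so is entry (i, j), hence \<open>v $ i = 0\<close> and that diagonal
  entry stays zero.\<close>

lemma psd_deflation:
  assumes A: "A \<in> psd_mats n" and j: "j < n" and pos: "0 < A $$ (j, j)"
  defines "v \<equiv> vec n (\<lambda>i. A $$ (i, j) / sqrt (A $$ (j, j)))"
  shows "A - outer v \<in> psd_mats n"
    and "i < n \<Longrightarrow> A $$ (i, i) = 0 \<Longrightarrow> (A - outer v) $$ (i, i) = 0"
    and "(A - outer v) $$ (j, j) = 0"
    and "(v $ j)\<^sup>2 = A $$ (j, j)"
proof -
  note A' = psd_matsD[OF A]
  have v: "v \<in> carrier_vec n"
    by (simp add: v_def)
  show vj: "(v $ j)\<^sup>2 = A $$ (j, j)"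
    using j pos by (simp add: v_def power_divide power2_eq_square)
  show "(A - outer v) $$ (j, j) = 0"
    using A'(1) j v vj by (simp add: outer_def power2_eq_square)
  show "(A - outer v) $$ (i, i) = 0" if "i < n" "A $$ (i, i) = 0"
    using psd_entry_sq_le[OF A that(1) j] that v A'(1) by (simp add: outer_def v_def)
  have "0 \<le> x \<bullet> ((A - outer v) *\<^sub>v x)" if x: "x \<in> carrier_vec n" for x
  proof -
    have "x \<bullet> v = (x \<bullet> (A *\<^sub>v unit_vec n j)) / sqrt (A $$ (j, j))"
      using A'(1) j x by (simp add: mat_mult_unit_vec scalar_prod_def v_def sum_divide_distrib)
    then have "(x \<bullet> v)\<^sup>2 = (x \<bullet> (A *\<^sub>v unit_vec n j))\<^sup>2 / A $$ (j, j)"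
      using pos by (simp add: power_divide)
    also have "\<dots> \<le> x \<bullet> (A *\<^sub>v x)"
      using psd_Cauchy_Schwarz[OF A x unit_vec_carrier, of j] A'(1) j pos
      by (simp add: unit_vec_form divide_le_eq)
    finally have "0 \<le> x \<bullet> (A *\<^sub>v x) - x \<bullet> (outer v *\<^sub>v x)"
      using outer_form[OF v x] by simp
    also have "\<dots> = x \<bullet> ((A - outer v) *\<^sub>v x)"
      using A'(1) outer_carrier[OF v] x
      by (simp add: minus_mult_distrib_mat_vec[of _ n n] scalar_prod_minus_distrib[of _ n])
    finally show ?thesis .
  qed
  moreover have "transpose_mat (A - outer v) = A - outer v"
    using A'(1,2) psd_matsD(2)[OF outer_mem_psd_mats[OF v]] outer_carrier[OF v]
    by (simp add: transpose_minus[of _ n n])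
  ultimately show "A - outer v \<in> psd_mats n"
    using A'(1) outer_carrier[OF v] by (simp add: psd_mats_def minus_carrier_mat)
qed

lemma psd_eq_zero:
  assumes A: "A \<in> psd_mats n" and diag: "\<And>j. j < n \<Longrightarrow> A $$ (j, j) = 0"
  shows "A = 0\<^sub>m n n"
  using psd_entry_sq_le[OF A] diag psd_matsD(1)[OF A] by (intro eq_matI) auto

text \<open>Induction on the number of nonzero diagonal entries: deflation splits off a rank-one summand
  and annihilates one of them.\<close>

lemma det_le_det_add_psd:
  assumes "P \<in> pd_mats n" "A \<in> psd_mats n"
  shows "det P \<le> det (P + A)"
  using assms
proof (induction "card {j. j < n \<and> A $$ (j, j) \<noteq> 0}" arbitrary: P A rule: less_induct)
  case less
  note A' = psd_matsD[OF less.prems(2)]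
  note P' = pd_matsD[OF less.prems(1)]
  show ?case
  proof (cases "\<exists>j<n. A $$ (j, j) \<noteq> 0")
    case False
    then have "A = 0\<^sub>m n n"
      using psd_eq_zero[OF less.prems(2)] by blast
    then show ?thesis using P'(1) by simp
  next
    case True
    then obtain j where j: "j < n" and "A $$ (j, j) \<noteq> 0" by blast
    then have pos: "0 < A $$ (j, j)"
      using psd_diag_nonneg[OF less.prems(2) j] by simp
    define v where "v = vec n (\<lambda>i. A $$ (i, j) / sqrt (A $$ (j, j)))"
    have v: "v \<in> carrier_vec n" by (simp add: v_def)
    note defl = psd_deflation[OF less.prems(2) j pos, folded v_def]
    have "card {i. i < n \<and> (A - outer v) $$ (i, i) \<noteq> 0} < card {i. i < n \<and> A $$ (i, i) \<noteq> 0}"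
      using defl(2,3) j pos by (intro psubset_card_mono) auto
    \<comment> \<open>The induction hypothesis is used with the shifted base
      \<open>P + outer v\<close>, which is why \<open>P\<close> varies in the induction.\<close>
    then have "det (P + outer v) \<le> det (P + outer v + (A - outer v))"
      using less.prems defl(1) by (intro less.hyps pd_add_psd outer_mem_psd_mats v)
    also have "P + outer v + (A - outer v) = P + A"
      using P'(1) A'(1) outer_carrier[OF v] by (intro eq_matI) auto
    finally have "det (P + outer v) \<le> det (P + A)" .
    moreover have "det P \<le> det (P + outer v)"
      using pd_det_pos[OF less.prems(1)] pd_inverse_form(1)[OF less.prems(1) v]
      by (simp add: det_add_outer[OF less.prems(1) v])
    ultimately show ?thesis by linarith
  qed
qed

text \<open>A single deflation at j suffices. The rank-one summand multiplies the determinant by 1 +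
  v . P^-1 v, where the inverse form is at least \<open>(v $ j)\<^sup>2 / P $$ (j, j)\<close> and
  \<open>(v $ j)\<^sup>2 = A $$ (j, j)\<close>; adding the positive semidefinite remainder cannot
  decrease the determinant.\<close>

lemma det_add_psd_growth:
  assumes P: "P \<in> pd_mats n" and A: "A \<in> psd_mats n" and j: "j < n"
  shows "det P * (1 + A $$ (j, j) / P $$ (j, j)) \<le> det (P + A)"
proof (cases "A $$ (j, j) = 0")
  case True
  with det_le_det_add_psd[OF P A] show ?thesis by simp
next
  case False
  then have pos: "0 < A $$ (j, j)"
    using psd_diag_nonneg[OF A j] by simp
  define v where "v = vec n (\<lambda>i. A $$ (i, j) / sqrt (A $$ (j, j)))"
  have v: "v \<in> carrier_vec n" by (simp add: v_def)
  note defl = psd_deflation[OF A j pos, folded v_def]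
  note detP = pd_det_pos[OF P]
  have "A $$ (j, j) / P $$ (j, j) \<le> v \<bullet> (inv_mat P *\<^sub>v v)"
    using pd_inverse_form(2)[OF P v j] pd_diag_pos[OF P j] defl(4) by (simp add: divide_le_eq mult.commute)
  then have "det P * (1 + A $$ (j, j) / P $$ (j, j)) \<le> det (P + outer v)"
    using detP by (simp add: det_add_outer[OF P v])
  also have "\<dots> \<le> det (P + outer v + (A - outer v))"
    by (intro det_le_det_add_psd[of _ n] pd_add_psd P outer_mem_psd_mats v defl(1))
  also have "P + outer v + (A - outer v) = P + A"
    using pd_matsD(1)[OF P] psd_matsD(1)[OF A] outer_carrier[OF v] by (intro eq_matI) auto
  finally show ?thesis .
qed

section \<open>Generalized inverses\<close>

text \<open>The matrix \<open>P l j = (\<Sum>i\<in>I. c i l * z i j)\<close> is \<open>M * Z\<close> for a generalized inverse \<open>M\<close>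
  of the matrix \<open>Z\<close> with rows \<open>z i\<close>, i.e. \<open>Z * M * Z = Z\<close>. When a row \<open>z a\<close> is added, put
  \<open>w = z a * (1 - P)\<close> and replace \<open>P\<close> by \<open>P + u * w\<close> with \<open>u = (1 - P) * w / (w \<bullet> w)\<close>: the old rows
  annihilate \<open>u\<close>, while \<open>z a \<bullet> u = 1\<close> unless \<open>w = 0\<close>.\<close>

lemma generalized_inverse_rows:
  fixes z :: "'i \<Rightarrow> nat \<Rightarrow> real"
  assumes "finite I"
  shows "\<exists>c. \<forall>k\<in>I. \<forall>j<q. (\<Sum>l<q. z k l * (\<Sum>i\<in>I. c i l * z i j)) = z k j"
  using assms
proof (induction I)
  case empty
  show ?case by simp
next
  case (insert a I)
  then obtain c where c: "\<And>k j. k \<in> I \<Longrightarrow> j < q \<Longrightarrow> (\<Sum>l<q. z k l * (\<Sum>i\<in>I. c i l * z i j)) = z k j"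
    by blast
  define P where "P l j = (\<Sum>i\<in>I. c i l * z i j)" for l j
  define w where "w j = z a j - (\<Sum>l<q. z a l * P l j)" for j
  define d where "d = (\<Sum>j<q. w j * w j)"
  define u where "u l = (w l - (\<Sum>j<q. P l j * w j)) / d" for l
  \<comment> \<open>Expanding \<open>w\<close> in rows gives \<open>z a\<close> minus each old row
    \<open>z i\<close> with weight \<open>\<Sum>h<q. z a h * c i h\<close>. So in
    \<open>P + u * w\<close> the new row has coefficient \<open>u\<close>, and each old coefficient
    loses its weight times \<open>u\<close>.\<close>
  define e where "e i l = (if i = a then u l else c i l - (\<Sum>h<q. z a h * c i h) * u l)" for i l
  have zP: "(\<Sum>l<q. z k l * P l j) = z k j" if "k \<in> I" "j < q" for k j
    using c that by (simp add: P_def)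
  have zPw: "(\<Sum>l<q. z k l * (\<Sum>j<q. P l j * w j)) = (\<Sum>j<q. (\<Sum>l<q. z k l * P l j) * w j)" for k
    unfolding sum_distrib_left sum_distrib_right by (subst sum.swap) (simp add: mult.assoc)
  have zu: "(\<Sum>l<q. z k l * u l) = ((\<Sum>l<q. z k l * w l) - (\<Sum>j<q. (\<Sum>l<q. z k l * P l j) * w j)) / d" for k
  proof -
    have "(\<Sum>l<q. z k l * u l) = (\<Sum>l<q. z k l * w l - z k l * (\<Sum>j<q. P l j * w j)) / d"
      by (simp add: u_def right_diff_distrib sum_divide_distrib)
    then show ?thesis
      by (simp add: sum_subtractf zPw)
  qed
  have zu0: "(\<Sum>l<q. z k l * u l) = 0" if "k \<in> I" for k
    using zP[OF that] by (simp add: zu)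
  have zau: "(\<Sum>l<q. z a l * u l) = d / d"
  proof -
    have "(\<Sum>l<q. z a l * w l) - (\<Sum>j<q. (\<Sum>l<q. z a l * P l j) * w j) = d"
      by (simp add: d_def w_def left_diff_distrib flip: sum_subtractf)
    then show ?thesis by (simp add: zu)
  qed
  have e: "(\<Sum>i\<in>insert a I. e i l * z i j) = P l j + u l * w j" if "j < q" for l j
  proof -
    have "(\<Sum>i\<in>I. e i l * z i j) = (\<Sum>i\<in>I. c i l * z i j - u l * (\<Sum>h<q. z a h * (c i h * z i j)))"
      using insert.hyps
      by (intro sum.cong) (auto simp: e_def algebra_simps sum_distrib_left)
    also have "\<dots> = P l j - u l * (\<Sum>i\<in>I. \<Sum>h<q. z a h * (c i h * z i j))"
      by (simp add: P_def sum_subtractf sum_distrib_left)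
    also have "(\<Sum>i\<in>I. \<Sum>h<q. z a h * (c i h * z i j)) = (\<Sum>h<q. z a h * P h j)"
      unfolding P_def sum_distrib_left by (rule sum.swap)
    finally show ?thesis
      using insert.hyps by (simp add: e_def w_def algebra_simps)
  qed
  have main: "(\<Sum>l<q. z k l * (\<Sum>i\<in>insert a I. e i l * z i j))
      = (\<Sum>l<q. z k l * P l j) + (\<Sum>l<q. z k l * u l) * w j" if "j < q" for k j
    using e[OF that] by (simp add: distrib_left sum.distrib sum_distrib_right mult.assoc)
  \<comment> \<open>For \<open>d = 0\<close> the quotient \<open>d / d\<close> is 0 by convention,
    but then \<open>w\<close> vanishes on all indices below \<open>q\<close>, so both cases are
    covered by one equation.\<close>
  have wd: "d / d * w j = w j" if "j < q" for j
  proof (cases "d = 0")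
    case True
    then have "w j * w j = 0"
      using that unfolding d_def by (subst (asm) sum_nonneg_eq_0_iff) auto
    then show ?thesis by simp
  qed simp
  have "(\<Sum>l<q. z k l * (\<Sum>i\<in>insert a I. e i l * z i j)) = z k j" if "k \<in> insert a I" "j < q" for k j
  proof (cases "k = a")
    case True
    then show ?thesis
      unfolding main[OF that(2)] True zau wd[OF that(2)] by (simp add: w_def)
  next
    case False
    then show ?thesis
      using that main[OF that(2), of k] zu0 zP by simp
  qed
  then show ?case by blast
qed

text \<open>The row version is applied to all rows of all \<open>Z i\<close> at once, indexed by
  pairs. Each entry of \<open>P *\<^sub>v x\<close> is a combination, with coefficients
  \<open>c\<close> independent of \<open>x\<close>, of the entries of the vectors
  \<open>Z i *\<^sub>v x\<close>. Hence a bound on the latter transfers with a uniform factor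
  \<open>K\<close>.\<close>

lemma generalized_inverse_projection:
  fixes Z :: "nat \<Rightarrow> real mat"
  assumes Z: "\<And>i. i < m \<Longrightarrow> Z i \<in> carrier_mat (n i) q"
  shows "\<exists>P \<in> carrier_mat q q. \<exists>K. (\<forall>i<m. Z i * P = Z i) \<and>
    (\<forall>x \<in> carrier_vec q. \<forall>C. (\<forall>i<m. \<forall>j<n i. \<bar>(Z i *\<^sub>v x) $ j\<bar> \<le> C) \<longrightarrow>
      (\<forall>l<q. \<bar>(P *\<^sub>v x) $ l\<bar> \<le> K * C))"
proof -
  define I where "I = Sigma {..<m} (\<lambda>i. {..<n i})"
  define z where "z k l = Z (fst k) $$ (snd k, l)" for k l
  have fin: "finite I" by (simp add: I_def)
  obtain c where c: "\<And>k j. k \<in> I \<Longrightarrow> j < q \<Longrightarrow> (\<Sum>l<q. z k l * (\<Sum>i\<in>I. c i l * z i j)) = z k j"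
    using generalized_inverse_rows[OF fin, of q z] by blast
  define P where "P = mat q q (\<lambda>(l, j). \<Sum>i\<in>I. c i l * z i j)"
  define K where "K = (\<Sum>l<q. \<Sum>i\<in>I. \<bar>c i l\<bar>)"
  have P: "P \<in> carrier_mat q q"
    by (simp add: P_def)
  have ZP: "Z i * P = Z i" if i: "i < m" for i
  proof (rule eq_matI)
    fix a b assume "a < dim_row (Z i)" "b < dim_col (Z i)"
    then have ab: "a < n i" "b < q" using Z[OF i] by auto
    have "(Z i * P) $$ (a, b) = (\<Sum>l<q. z (i, a) l * (\<Sum>k\<in>I. c k l * z k b))"
      using Z[OF i] ab by (simp add: P_def scalar_prod_def z_def lessThan_atLeast0)
    also have "\<dots> = Z i $$ (a, b)"
      using ab i by (subst c) (auto simp: I_def z_def)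
    finally show "(Z i * P) $$ (a, b) = Z i $$ (a, b)" .
  qed (use Z[OF i] P in auto)
  have bound: "\<bar>(P *\<^sub>v x) $ l\<bar> \<le> K * C"
    if x: "x \<in> carrier_vec q" and C: "\<And>i j. i < m \<Longrightarrow> j < n i \<Longrightarrow> \<bar>(Z i *\<^sub>v x) $ j\<bar> \<le> C" and l: "l < q"
    for x C l
  proof -
    have zx: "\<bar>\<Sum>j<q. z k j * x $ j\<bar> \<le> C" if kI: "k \<in> I" for k
    proof -
      obtain i a where k: "k = (i, a)" "i < m" "a < n i"
        using kI by (auto simp: I_def)
      have "(\<Sum>j<q. z k j * x $ j) = (Z i *\<^sub>v x) $ a"
        using Z[OF k(2)] k x by (simp add: z_def scalar_prod_def lessThan_atLeast0)
      then show ?thesis using C[OF k(2,3)] by simp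
    qed
    have "(P *\<^sub>v x) $ l = (\<Sum>j<q. \<Sum>k\<in>I. c k l * (z k j * x $ j))"
      using l x by (simp add: P_def scalar_prod_def lessThan_atLeast0 sum_distrib_right mult.assoc)
    also have "\<dots> = (\<Sum>k\<in>I. c k l * (\<Sum>j<q. z k j * x $ j))"
      by (subst sum.swap) (simp add: sum_distrib_left)
    finally have "\<bar>(P *\<^sub>v x) $ l\<bar> \<le> (\<Sum>k\<in>I. \<bar>c k l * (\<Sum>j<q. z k j * x $ j)\<bar>)"
      by simp
    also have "\<dots> \<le> (\<Sum>k\<in>I. \<bar>c k l\<bar> * C)"
      using zx by (intro sum_mono) (simp add: abs_mult mult_left_mono)
    also have "\<dots> = (\<Sum>k\<in>I. \<bar>c k l\<bar>) * C"
      by (simp add: sum_distrib_right)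
    also have "\<dots> \<le> K * C"
    \<comment> \<open>The sign of \<open>C\<close> is not assumed: any row forces it to be
      nonnegative, and without rows \<open>K\<close> is 0.\<close>
    proof (cases "I = {}")
      case False
      then obtain k where "k \<in> I" by auto
      from zx[OF this] have "0 \<le> C" by linarith
      moreover have "(\<Sum>k\<in>I. \<bar>c k l\<bar>) \<le> K"
        unfolding K_def using l by (intro member_le_sum) (auto intro: sum_nonneg)
      ultimately show ?thesis by (rule mult_right_mono[rotated])
    qed (simp add: K_def)
    finally show ?thesis .
  qed
  show ?thesis
    by (intro bexI[OF _ P] exI[of _ K]) (simp add: ZP bound)
qed

section \<open>Bounded positive semidefinite representatives\<close>

lemma form_entry:
  fixes Z W G :: "real mat"
  assumes "Z \<in> carrier_mat n q" "G \<in> carrier_mat q q" "W \<in> carrier_mat n q" "i < n" "j < n"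
  shows "(Z * G * transpose_mat W) $$ (i, j) = row Z i \<bullet> (G *\<^sub>v row W j)"
proof -
  have "transpose_mat W \<in> carrier_mat q n"
    using assms(3) by simp
  then have "(Z * G * transpose_mat W) $$ (i, j) = (Z * (G * transpose_mat W)) $$ (i, j)"
    using assms(1,2) by (subst assoc_mult_mat) auto
  also have "\<dots> = row Z i \<bullet> col (G * transpose_mat W) j"
    using assms by (intro index_mult_mat(1)) auto
  also have "col (G * transpose_mat W) j = G *\<^sub>v row W j"
    using assms by (subst col_mult2[of _ q q _ n]) auto
  finally show ?thesis .
qed

text \<open>The representative is \<open>H = P * G * transpose_mat P\<close>, and
  \<open>Z i * P = Z i\<close> keeps every \<open>Z i * G * transpose_mat (Z i)\<close> unchanged.
  Cauchy-Schwarz extends the diagonal bound to the forms between any two rows, also from different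
  blocks. Transferring this bound through \<open>P\<close> once on each side of \<open>G\<close>
  produces the factor \<open>K * K\<close>.\<close>

lemma psd_bounded_representative:
  fixes Z :: "nat \<Rightarrow> real mat"
  assumes Z: "\<And>i. i < m \<Longrightarrow> Z i \<in> carrier_mat (n i) q"
  obtains K where "\<And>G C. G \<in> psd_mats q \<Longrightarrow>
      (\<And>i j. i < m \<Longrightarrow> j < n i \<Longrightarrow> (Z i * G * transpose_mat (Z i)) $$ (j, j) \<le> C) \<Longrightarrow>
      \<exists>G' \<in> psd_mats q. (\<forall>i<m. Z i * G' * transpose_mat (Z i) = Z i * G * transpose_mat (Z i)) \<and>
        (\<forall>a<q. \<forall>b<q. \<bar>G' $$ (a, b)\<bar> \<le> K * C)"
proof -
  obtain P K where P: "P \<in> carrier_mat q q" and PK: "(\<forall>i<m. Z i * P = Z i) \<and>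
    (\<forall>x \<in> carrier_vec q. \<forall>C. (\<forall>i<m. \<forall>j<n i. \<bar>(Z i *\<^sub>v x) $ j\<bar> \<le> C) \<longrightarrow>
      (\<forall>l<q. \<bar>(P *\<^sub>v x) $ l\<bar> \<le> K * C))"
    using generalized_inverse_projection[of m Z n q, OF Z] by blast
  have ZP: "Z i * P = Z i" if "i < m" for i
    using PK that by simp
  have bound: "\<bar>(P *\<^sub>v x) $ l\<bar> \<le> K * C"
    if "x \<in> carrier_vec q" "\<And>i j. i < m \<Longrightarrow> j < n i \<Longrightarrow> \<bar>(Z i *\<^sub>v x) $ j\<bar> \<le> C" "l < q" for x C l
    by (rule conjunct2[OF PK, rule_format, OF that(1) _ that(3)]) (rule that(2))
  show thesis
  proof (rule that[of "K * K"])
    fix G C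
    assume G: "G \<in> psd_mats q"
      and C: "\<And>i j. i < m \<Longrightarrow> j < n i \<Longrightarrow> (Z i * G * transpose_mat (Z i)) $$ (j, j) \<le> C"
    note G' = psd_matsD[OF G]
    define H where "H = P * G * transpose_mat P"
    have row: "row (Z i) j \<in> carrier_vec q" if "i < m" for i j
      using Z[OF that] by auto
    have diag: "row (Z i) j \<bullet> (G *\<^sub>v row (Z i) j) \<le> C" if "i < m" "j < n i" for i j
    proof -
      have "(Z i * G * transpose_mat (Z i)) $$ (j, j) = row (Z i) j \<bullet> (G *\<^sub>v row (Z i) j)"
        by (rule form_entry[OF Z[OF that(1)] G'(1) Z[OF that(1)] that(2,2)])
      then show ?thesis using C[OF that] by simp
    qed
    have cross: "\<bar>row (Z i) j \<bullet> (G *\<^sub>v row (Z h) k)\<bar> \<le> C" if "i < m" "j < n i" "h < m" "k < n h" for i j h k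
    proof -
      have nn: "0 \<le> row (Z i) j \<bullet> (G *\<^sub>v row (Z i) j)" "0 \<le> row (Z h) k \<bullet> (G *\<^sub>v row (Z h) k)"
        using G'(3) row that by auto
      have d: "row (Z i) j \<bullet> (G *\<^sub>v row (Z i) j) \<le> C" "row (Z h) k \<bullet> (G *\<^sub>v row (Z h) k) \<le> C"
        using diag that by blast+
      have "0 \<le> C"
        using nn(1) d(1) by linarith
      have "(row (Z i) j \<bullet> (G *\<^sub>v row (Z h) k))\<^sup>2
          \<le> (row (Z i) j \<bullet> (G *\<^sub>v row (Z i) j)) * (row (Z h) k \<bullet> (G *\<^sub>v row (Z h) k))"
        using that by (intro psd_Cauchy_Schwarz[OF G row row])
      also have "\<dots> \<le> C * C"
        by (intro mult_mono d nn \<open>0 \<le> C\<close>)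
      finally show ?thesis
        using abs_le_square_iff[of _ C] \<open>0 \<le> C\<close> by (simp add: power2_eq_square)
    qed
    have PGz: "\<bar>(P *\<^sub>v (G *\<^sub>v row (Z h) k)) $ l\<bar> \<le> K * C" if "h < m" "k < n h" "l < q" for h k l
    proof (rule bound)
      show "G *\<^sub>v row (Z h) k \<in> carrier_vec q"
        using G'(1) row[OF that(1)] by simp
      show "\<bar>(Z i *\<^sub>v (G *\<^sub>v row (Z h) k)) $ j\<bar> \<le> C" if "i < m" "j < n i" for i j
        using cross[OF that \<open>h < m\<close> \<open>k < n h\<close>] Z[OF that(1)] that(2) by simp
    qed fact
    have "\<bar>H $$ (a, b)\<bar> \<le> K * (K * C)" if "a < q" "b < q" for a b
    proof -
      define x where "x = G *\<^sub>v row P b"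
      have rP: "row P b \<in> carrier_vec q" using P by auto
      have "H $$ (a, b) = row P a \<bullet> x"
        unfolding H_def x_def by (rule form_entry[OF P G'(1) P that])
      then have "H $$ (a, b) = (P *\<^sub>v x) $ a"
        using P that by simp
      \<comment> \<open>Symmetry of \<open>G\<close> exchanges the two sides, so these entries are
        already bounded by \<open>PGz\<close>; this prepares the second transfer through
        \<open>P\<close>.\<close>
      moreover have "\<bar>(Z i *\<^sub>v x) $ j\<bar> \<le> K * C" if ij: "i < m" "j < n i" for i j
      proof -
        have "(Z i *\<^sub>v x) $ j = row (Z i) j \<bullet> (G *\<^sub>v row P b)"
          using ij Z[OF ij(1)] by (simp add: x_def)
        also have "\<dots> = row P b \<bullet> (G *\<^sub>v row (Z i) j)"
          by (rule symmetric_form_commute[OF G'(1,2) row[OF ij(1)] rP])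
        also have "\<dots> = (P *\<^sub>v (G *\<^sub>v row (Z i) j)) $ b"
          using P \<open>b < q\<close> by simp
        finally show ?thesis using PGz[OF ij \<open>b < q\<close>] by simp
      qed
      ultimately show ?thesis
        using bound[of x "K * C" a] G'(1) rP that by (simp add: x_def)
    qed
    moreover have "H \<in> psd_mats q"
      unfolding H_def by (rule congruence_mem_psd_mats[OF P G])
    moreover have "Z i * H * transpose_mat (Z i) = Z i * G * transpose_mat (Z i)" if "i < m" for i
    proof -
      define W where "W = transpose_mat (Z i)"
      define Q where "Q = transpose_mat P"
      have c: "Z i \<in> carrier_mat (n i) q" "W \<in> carrier_mat q (n i)" "Q \<in> carrier_mat q q"
        using Z[OF that] P by (auto simp: W_def Q_def)
      have "Z i * (P * G * Q) * W = Z i * (P * G) * Q * W"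
        using c P G'(1) by (subst assoc_mult_mat[of "Z i" "n i" q "P * G" q Q q]) auto
      also have "\<dots> = Z i * (P * G) * (Q * W)"
        using c P G'(1) by (intro assoc_mult_mat) auto
      also have "\<dots> = Z i * P * G * (Q * W)"
        using c P G'(1) by (subst assoc_mult_mat[of "Z i" "n i" q P q G q]) auto
      also have "\<dots> = (Z i * P) * G * transpose_mat (Z i * P)"
        using transpose_mult[OF c(1) P] by (simp add: W_def Q_def)
      finally have "Z i * H * transpose_mat (Z i) = (Z i * P) * G * transpose_mat (Z i * P)"
        by (simp add: H_def W_def Q_def)
      then show ?thesis by (simp add: ZP[OF that])
    qed
    ultimately show "\<exists>G' \<in> psd_mats q. (\<forall>i<m. Z i * G' * transpose_mat (Z i) = Z i * G * transpose_mat (Z i)) \<and>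
        (\<forall>a<q. \<forall>b<q. \<bar>G' $$ (a, b)\<bar> \<le> K * K * C)"
      by (intro bexI[of _ H]) (auto simp: mult.assoc)
  qed
qed

section \<open>Existence of a minimizer\<close>

text \<open>Bolzano-Weierstrass for finitely many coordinates. Each new coordinate refines the
  subsequence found so far to a monotone one, which converges because it is bounded; earlier limits
  survive the refinement.\<close>

lemma bounded_family_convergent_subseq:
  fixes a :: "nat \<Rightarrow> 'i \<Rightarrow> real"
  assumes "finite I" "\<And>k i. i \<in> I \<Longrightarrow> \<bar>a k i\<bar> \<le> C"
  shows "\<exists>r l. strict_mono r \<and> (\<forall>i\<in>I. (\<lambda>k. a (r k) i) \<longlonglongrightarrow> l i)"
  using assms
proof (induction I)
  case empty
  show ?case by (auto intro: strict_mono_id)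
next
  case (insert i I)
  have "\<exists>r l. strict_mono r \<and> (\<forall>j\<in>I. (\<lambda>k. a (r k) j) \<longlonglongrightarrow> l j)"
    using insert.prems by (intro insert.IH) auto
  then obtain r l where r: "strict_mono r" "\<And>j. j \<in> I \<Longrightarrow> (\<lambda>k. a (r k) j) \<longlonglongrightarrow> l j"
    by blast
  obtain s where s: "strict_mono s" "monoseq (\<lambda>k. a (r (s k)) i)"
    using seq_monosub[of "\<lambda>k. a (r k) i"] by auto
  have "Bseq (\<lambda>k. a (r (s k)) i)"
    by (rule BseqI'[of _ C]) (use insert.prems in auto)
  then obtain c where c: "(\<lambda>k. a (r (s k)) i) \<longlonglongrightarrow> c"
    using Bseq_monoseq_convergent s(2) by (auto simp: convergent_def)
  have "(\<lambda>k. a ((r \<circ> s) k) j) \<longlonglongrightarrow> (l(i := c)) j" if "j \<in> insert i I" for j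
  proof (cases "j = i")
    case True
    with c show ?thesis by simp
  next
    case False
    with that have "(\<lambda>k. a (r k) j) \<longlonglongrightarrow> l j" by (simp add: r(2))
    from LIMSEQ_subseq_LIMSEQ[OF this s(1)] False show ?thesis by (simp add: o_def)
  qed
  moreover have "strict_mono (r \<circ> s)"
    using r(1) s(1) by (rule strict_mono_o)
  ultimately show ?case by blast
qed

lemma psd_mats_closed:
  assumes "\<And>k. g k \<in> psd_mats q" "mat_tendsto q q g G sequentially"
  shows "G \<in> psd_mats q"
proof -
  have G: "G \<in> carrier_mat q q"
    using assms(2) by (simp add: mat_tendsto_def)
  have "transpose_mat G = G"
  proof (rule eq_matI)
    fix i j assume "i < dim_row G" "j < dim_col G"
    then have ij: "i < q" "j < q" using G by auto
    have "g k $$ (j, i) = g k $$ (i, j)" for k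
      using psd_matsD[OF assms(1)[of k]] ij by (metis carrier_matD index_transpose_mat(1))
    moreover have "(\<lambda>k. g k $$ (j, i)) \<longlonglongrightarrow> G $$ (j, i)" "(\<lambda>k. g k $$ (i, j)) \<longlonglongrightarrow> G $$ (i, j)"
      using assms(2) ij by (auto simp: mat_tendsto_def)
    ultimately have "G $$ (j, i) = G $$ (i, j)"
      using LIMSEQ_unique by simp
    then show "transpose_mat G $$ (i, j) = G $$ (i, j)"
      using ij G by simp
  qed (use G in auto)
  moreover have "0 \<le> x \<bullet> (G *\<^sub>v x)" if x: "x \<in> carrier_vec q" for x
  proof (rule LIMSEQ_le_const)
    show "(\<lambda>k. x \<bullet> (g k *\<^sub>v x)) \<longlonglongrightarrow> x \<bullet> (G *\<^sub>v x)"
      using x by (intro tendsto_scalar_prod[of q] vec_tendsto_const mat_tendsto_mult_vec[OF assms(2)])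
  qed (use psd_matsD(3)[OF assms(1) x] in auto)
  ultimately show ?thesis
    using G by (simp add: psd_mats_def)
qed

section \<open>The likelihood and its sublevel sets\<close>

locale mixed_model =
  fixes m p q :: nat and n :: "nat \<Rightarrow> nat"
    and X Z \<Lambda> :: "nat \<Rightarrow> real mat" and Y :: "nat \<Rightarrow> real Matrix.vec"
  assumes X: "\<And>i. i < m \<Longrightarrow> X i \<in> carrier_mat (n i) p"
    and Z: "\<And>i. i < m \<Longrightarrow> Z i \<in> carrier_mat (n i) q"
    and Y: "\<And>i. i < m \<Longrightarrow> Y i \<in> carrier_vec (n i)"
    and \<Lambda>: "\<And>i. i < m \<Longrightarrow> \<Lambda> i \<in> pd_mats (n i)"
begin

abbreviation "cov i \<Gamma> \<equiv> Z i * \<Gamma> * transpose_mat (Z i)"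
abbreviation "Om i \<Gamma> \<equiv> Omega (Z i) (\<Lambda> i) \<Gamma>"
abbreviation "resid i \<beta> \<equiv> Y i - X i *\<^sub>v \<beta>"
abbreviation "form i \<beta> \<Gamma> \<equiv> resid i \<beta> \<bullet> (inv_mat (Om i \<Gamma>) *\<^sub>v resid i \<beta>)"
abbreviation "L \<equiv> L_ML m X Z Y \<Lambda>"

lemma cov_psd: "i < m \<Longrightarrow> \<Gamma> \<in> psd_mats q \<Longrightarrow> cov i \<Gamma> \<in> psd_mats (n i)"
  by (rule congruence_mem_psd_mats[OF Z])

text \<open>Puts the positive definite summand first, the shape required by the determinant
  estimates with base \<open>\<Lambda> i\<close>.\<close>

lemma Om_eq: "i < m \<Longrightarrow> \<Gamma> \<in> psd_mats q \<Longrightarrow> Om i \<Gamma> = \<Lambda> i + cov i \<Gamma>"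
  unfolding Omega_def by (rule comm_add_mat[OF psd_matsD(1)[OF cov_psd] pd_matsD(1)[OF \<Lambda>]])

lemma Om_pd: "i < m \<Longrightarrow> \<Gamma> \<in> psd_mats q \<Longrightarrow> Om i \<Gamma> \<in> pd_mats (n i)"
  unfolding Om_eq by (intro pd_add_psd \<Lambda> cov_psd)

lemma resid_carrier: "i < m \<Longrightarrow> \<beta> \<in> carrier_vec p \<Longrightarrow> resid i \<beta> \<in> carrier_vec (n i)"
  using X Y by (intro minus_carrier_vec mult_mat_vec_carrier) auto

lemma L_eq_sum: "2 * L \<beta> \<Gamma> = (\<Sum>i<m. form i \<beta> \<Gamma> + ln (det (Om i \<Gamma>)))"
  by (simp add: L_ML_def sum_distrib_left distrib_left)

lemma form_nonneg: "i < m \<Longrightarrow> \<beta> \<in> carrier_vec p \<Longrightarrow> \<Gamma> \<in> psd_mats q \<Longrightarrow> 0 \<le> form i \<beta> \<Gamma>"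
  by (rule pd_inverse_form(1)[OF Om_pd resid_carrier])

lemma ln_det_ge:
  assumes "i < m" "\<Gamma> \<in> psd_mats q"
  shows "ln (det (\<Lambda> i)) \<le> ln (det (Om i \<Gamma>))"
  unfolding Om_eq[OF assms]
  using det_le_det_add_psd[OF \<Lambda>[OF assms(1)] cov_psd[OF assms]] pd_det_pos[OF \<Lambda>[OF assms(1)]] by simp

text \<open>After subtracting \<open>ln (det (\<Lambda> i))\<close> every summand is nonnegative, so
  the total dominates each one. This turns a bound on \<open>L\<close> into a bound for every single
  block.\<close>

lemma term_le:
  assumes "i < m" "\<beta> \<in> carrier_vec p" "\<Gamma> \<in> psd_mats q"
  shows "form i \<beta> \<Gamma> + (ln (det (Om i \<Gamma>)) - ln (det (\<Lambda> i))) \<le> 2 * L \<beta> \<Gamma> - (\<Sum>i<m. ln (det (\<Lambda> i)))"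
proof -
  have "form i \<beta> \<Gamma> + (ln (det (Om i \<Gamma>)) - ln (det (\<Lambda> i)))
      \<le> (\<Sum>i<m. form i \<beta> \<Gamma> + (ln (det (Om i \<Gamma>)) - ln (det (\<Lambda> i))))"
    using assms form_nonneg ln_det_ge
    by (intro member_le_sum[where f = "\<lambda>i. form i \<beta> \<Gamma> + (ln (det (Om i \<Gamma>)) - ln (det (\<Lambda> i)))"]) auto
  then show ?thesis
    by (simp add: L_eq_sum sum.distrib sum_subtractf)
qed

lemma L_lower_bound:
  assumes "\<beta> \<in> carrier_vec p" "\<Gamma> \<in> psd_mats q"
  shows "(\<Sum>i<m. ln (det (\<Lambda> i))) / 2 \<le> L \<beta> \<Gamma>"
proof -
  have "(\<Sum>i<m. ln (det (\<Lambda> i))) \<le> 2 * L \<beta> \<Gamma>"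
    unfolding L_eq_sum
  proof (rule sum_mono)
    fix i assume "i \<in> {..<m}"
    then have "i < m" by simp
    then show "ln (det (\<Lambda> i)) \<le> form i \<beta> \<Gamma> + ln (det (Om i \<Gamma>))"
      using form_nonneg[of i \<beta> \<Gamma>] ln_det_ge[of i \<Gamma>] assms by linarith
  qed
  then show ?thesis by simp
qed

lemma L_cong:
  assumes "\<And>i. i < m \<Longrightarrow> X i *\<^sub>v \<beta>' = X i *\<^sub>v \<beta>" "\<And>i. i < m \<Longrightarrow> cov i \<Gamma>' = cov i \<Gamma>"
  shows "L \<beta>' \<Gamma>' = L \<beta> \<Gamma>"
  unfolding L_ML_def Omega_def using assms by (intro sum.cong) auto

text \<open>By \<open>term_le\<close>, both the quadratic form and the increase of the
  log-determinant are at most \<open>K\<close> in each block. Exponentiating the latter and applying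
  the growth estimate bounds the diagonal of \<open>cov i \<Gamma>\<close>, hence that of
  \<open>Om i \<Gamma>\<close>; the estimate for the inverse form then bounds the residuals.\<close>

lemma sublevel_bound:
  obtains C where "\<And>\<beta> \<Gamma> i j. \<beta> \<in> carrier_vec p \<Longrightarrow> \<Gamma> \<in> psd_mats q \<Longrightarrow> L \<beta> \<Gamma> \<le> c \<Longrightarrow> i < m \<Longrightarrow> j < n i \<Longrightarrow>
    cov i \<Gamma> $$ (j, j) \<le> C \<and> \<bar>(X i *\<^sub>v \<beta>) $ j\<bar> \<le> C"
proof -
  define K where "K = \<bar>2 * c - (\<Sum>i<m. ln (det (\<Lambda> i)))\<bar>"
  \<comment> \<open>With l the diagonal entry of \<open>\<Lambda> i\<close>, \<open>D\<close>
    dominates both l * exp K, the bound for the covariance entry, and |Y| + l * (exp K + 1) * K + 1,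
    the bound for the fitted value. Summing over all indices in \<open>C\<close> gives one constant
    for all of them.\<close>
  define D where "D i j = \<Lambda> i $$ (j, j) * (exp K + 1) * (K + 1) + \<bar>Y i $ j\<bar> + 1" for i j
  define C where "C = (\<Sum>i<m. \<Sum>j<n i. D i j)"
  have \<Lambda>pos: "0 < \<Lambda> i $$ (j, j)" if "i < m" "j < n i" for i j
    using pd_diag_pos[OF \<Lambda>] that by blast
  have K: "0 \<le> K" by (simp add: K_def)
  have D0: "0 \<le> D i j" if "i < m" "j < n i" for i j
    using \<Lambda>pos[OF that] K by (auto simp: D_def intro!: add_nonneg_nonneg mult_nonneg_nonneg)
  have DC: "D i j \<le> C" if "i < m" "j < n i" for i j
  proof -
    have "D i j \<le> (\<Sum>j<n i. D i j)"
      using that D0 by (intro member_le_sum) auto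
    also have "\<dots> \<le> C"
      unfolding C_def using that D0
      by (intro member_le_sum[where f = "\<lambda>i. \<Sum>j<n i. D i j"]) (auto intro!: sum_nonneg)
    finally show ?thesis .
  qed
  show thesis
  proof (rule that[of C])
    fix \<beta> \<Gamma> i j
    assume \<beta>: "\<beta> \<in> carrier_vec p" and \<Gamma>: "\<Gamma> \<in> psd_mats q" and c: "L \<beta> \<Gamma> \<le> c" and i: "i < m" and j: "j < n i"
    define t where "t = form i \<beta> \<Gamma>"
    define a where "a = cov i \<Gamma> $$ (j, j)"
    define l where "l = \<Lambda> i $$ (j, j)"
    have l: "0 < l" using \<Lambda>pos[OF i j] by (simp add: l_def)
    have a: "0 \<le> a" using psd_diag_nonneg[OF cov_psd[OF i \<Gamma>] j] by (simp add: a_def)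
    have t: "0 \<le> t" using form_nonneg[OF i \<beta> \<Gamma>] by (simp add: t_def)
    note dL = pd_det_pos[OF \<Lambda>[OF i]]
    note dO = pd_det_pos[OF Om_pd[OF i \<Gamma>]]
    have K1: "t + (ln (det (Om i \<Gamma>)) - ln (det (\<Lambda> i))) \<le> K"
      using term_le[OF i \<beta> \<Gamma>] c by (simp add: t_def K_def)
    have tK: "t \<le> K"
      using K1 ln_det_ge[OF i \<Gamma>] by linarith
    have "det (\<Lambda> i) * (1 + a / l) \<le> det (Om i \<Gamma>)"
      unfolding Om_eq[OF i \<Gamma>] a_def l_def by (rule det_add_psd_growth[OF \<Lambda>[OF i] cov_psd[OF i \<Gamma>] j])
    also have "det (Om i \<Gamma>) = exp (ln (det (Om i \<Gamma>)))"
      using dO by simp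
    also have "\<dots> \<le> exp (ln (det (\<Lambda> i)) + K)"
      using K1 t by simp
    also have "\<dots> = det (\<Lambda> i) * exp K"
      using dL by (simp add: exp_add)
    finally have "1 + a / l \<le> exp K"
      using dL by simp
    then have "a / l \<le> exp K" by linarith
    then have al: "a \<le> l * exp K"
      using l by (simp add: divide_le_eq mult.commute)
    have "Om i \<Gamma> $$ (j, j) = l + a"
      unfolding Om_eq[OF i \<Gamma>] l_def a_def 
      using psd_matsD(1)[OF cov_psd[OF i \<Gamma>]] j by (subst index_add_mat(1)) auto
    then have "(resid i \<beta> $ j)\<^sup>2 \<le> (l + a) * t"
      using pd_inverse_form(2)[OF Om_pd[OF i \<Gamma>] resid_carrier[OF i \<beta>] j] by (simp add: t_def)
    also have "\<dots> \<le> (l * (exp K + 1)) * K"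
      using al tK t l K by (intro mult_mono) (auto simp: algebra_simps)
    finally have r2: "(resid i \<beta> $ j)\<^sup>2 \<le> l * (exp K + 1) * K" .
    \<comment> \<open>Converts the bound on the squared residual into one on its absolute value
      without square roots.\<close>
    have le: "\<bar>x\<bar> \<le> x\<^sup>2 + 1" for x :: real
      using zero_le_power2[of "\<bar>x\<bar> - 1"] by (simp add: power2_diff)
    have "resid i \<beta> $ j = Y i $ j - (X i *\<^sub>v \<beta>) $ j"
      using X[OF i] j by simp
    then have "\<bar>(X i *\<^sub>v \<beta>) $ j\<bar> \<le> \<bar>Y i $ j\<bar> + l * (exp K + 1) * K + 1"
      using le[of "resid i \<beta> $ j"] r2 by linarith
    also have "\<dots> \<le> D i j"
      using l by (simp add: D_def l_def[symmetric] distrib_left)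
    finally have "\<bar>(X i *\<^sub>v \<beta>) $ j\<bar> \<le> C"
      using DC[OF i j] by linarith
    moreover have "a \<le> D i j"
    proof -
      have "l * exp K \<le> l * (exp K + 1)"
        using l by simp
      also have "\<dots> \<le> l * (exp K + 1) * (K + 1)"
        using l K mult_left_mono[of 1 "K + 1" "l * (exp K + 1)"] by (simp add: add_nonneg_nonneg)
      finally show ?thesis
        using al by (simp add: D_def l_def)
    qed
    ultimately show "cov i \<Gamma> $$ (j, j) \<le> C \<and> \<bar>(X i *\<^sub>v \<beta>) $ j\<bar> \<le> C"
      using DC[OF i j] by (simp add: a_def)
  qed
qed

text \<open>Although the sublevel set may be unbounded, every value of \<open>L\<close> taken on it
  is also taken in one fixed box. The two arguments are replaced separately, each by means of its
  own stacked matrix.\<close>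

lemma sublevel_bounded_representative:
  obtains C where "\<And>\<beta> \<Gamma>. \<beta> \<in> carrier_vec p \<Longrightarrow> \<Gamma> \<in> psd_mats q \<Longrightarrow> L \<beta> \<Gamma> \<le> c \<Longrightarrow>
    \<exists>\<beta>' \<in> carrier_vec p. \<exists>\<Gamma>' \<in> psd_mats q. L \<beta>' \<Gamma>' = L \<beta> \<Gamma> \<and>
      (\<forall>l<p. \<bar>\<beta>' $ l\<bar> \<le> C) \<and> (\<forall>a<q. \<forall>b<q. \<bar>\<Gamma>' $$ (a, b)\<bar> \<le> C)"
proof -
  obtain B where B: "\<And>\<beta> \<Gamma> i j. \<beta> \<in> carrier_vec p \<Longrightarrow> \<Gamma> \<in> psd_mats q \<Longrightarrow> L \<beta> \<Gamma> \<le> c \<Longrightarrow> i < m \<Longrightarrow> j < n i \<Longrightarrow>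
    cov i \<Gamma> $$ (j, j) \<le> B \<and> \<bar>(X i *\<^sub>v \<beta>) $ j\<bar> \<le> B"
    using sublevel_bound[of c thesis] by blast
  obtain K where K: "\<And>G C. G \<in> psd_mats q \<Longrightarrow> (\<And>i j. i < m \<Longrightarrow> j < n i \<Longrightarrow> cov i G $$ (j, j) \<le> C) \<Longrightarrow>
      \<exists>G' \<in> psd_mats q. (\<forall>i<m. cov i G' = cov i G) \<and> (\<forall>a<q. \<forall>b<q. \<bar>G' $$ (a, b)\<bar> \<le> K * C)"
    using psd_bounded_representative[of m Z n q thesis, OF Z] by blast
  obtain P K' where P: "P \<in> carrier_mat p p" and PK: "(\<forall>i<m. X i * P = X i) \<and>
    (\<forall>x \<in> carrier_vec p. \<forall>C. (\<forall>i<m. \<forall>j<n i. \<bar>(X i *\<^sub>v x) $ j\<bar> \<le> C) \<longrightarrow>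
      (\<forall>l<p. \<bar>(P *\<^sub>v x) $ l\<bar> \<le> K' * C))"
    using generalized_inverse_projection[of m X n p, OF X] by blast
  show thesis
  proof (rule that[of "max (K * B) (K' * B)"])
    fix \<beta> \<Gamma>
    assume \<beta>: "\<beta> \<in> carrier_vec p" and \<Gamma>: "\<Gamma> \<in> psd_mats q" and c: "L \<beta> \<Gamma> \<le> c"
    have bd: "cov i \<Gamma> $$ (j, j) \<le> B" "\<bar>(X i *\<^sub>v \<beta>) $ j\<bar> \<le> B" if "i < m" "j < n i" for i j
      using B[OF \<beta> \<Gamma> c that] by auto
    obtain \<Gamma>' where \<Gamma>': "\<Gamma>' \<in> psd_mats q" "\<forall>i<m. cov i \<Gamma>' = cov i \<Gamma>" "\<forall>a<q. \<forall>b<q. \<bar>\<Gamma>' $$ (a, b)\<bar> \<le> K * B"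
      using K[OF \<Gamma> bd(1)] by blast
    have XP: "X i *\<^sub>v (P *\<^sub>v \<beta>) = X i *\<^sub>v \<beta>" if "i < m" for i
      using assoc_mult_mat_vec[OF X[OF that] P \<beta>] PK that by simp
    have "L (P *\<^sub>v \<beta>) \<Gamma>' = L \<beta> \<Gamma>"
      using XP \<Gamma>'(2) by (intro L_cong) auto
    moreover have "\<forall>l<p. \<bar>(P *\<^sub>v \<beta>) $ l\<bar> \<le> K' * B"
      using PK \<beta> bd(2) by blast
    moreover have "P *\<^sub>v \<beta> \<in> carrier_vec p"
      using P \<beta> by simp
    ultimately show "\<exists>\<beta>' \<in> carrier_vec p. \<exists>\<Gamma>' \<in> psd_mats q. L \<beta>' \<Gamma>' = L \<beta> \<Gamma> \<and>
      (\<forall>l<p. \<bar>\<beta>' $ l\<bar> \<le> max (K * B) (K' * B)) \<and> (\<forall>a<q. \<forall>b<q. \<bar>\<Gamma>' $$ (a, b)\<bar> \<le> max (K * B) (K' * B))"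
      using \<Gamma>'(1,3) by (intro bexI[of _ "P *\<^sub>v \<beta>"] bexI[of _ \<Gamma>']) (auto simp: le_max_iff_disj)
  qed
qed

section \<open>Continuity and attainment\<close>

text \<open>On positive semidefinite arguments the inverse is the adjugate over the determinant, so
  each quadratic form is a quotient of convergent expressions. The limit \<open>\<Gamma>\<close> is
  positive semidefinite too, so the limiting determinant is positive; this justifies both the
  quotient and the logarithm.\<close>

lemma tendsto_L:
  assumes b: "vec_tendsto p b \<beta> F" and g: "mat_tendsto q q g \<Gamma> F"
    and psd: "\<And>k. g k \<in> psd_mats q" "\<Gamma> \<in> psd_mats q"
  shows "((\<lambda>k. L (b k) (g k)) \<longlongrightarrow> L \<beta> \<Gamma>) F"
proof -
  have "((\<lambda>k. form i (b k) (g k)) \<longlongrightarrow> form i \<beta> \<Gamma>) F"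
    "((\<lambda>k. ln (det (Om i (g k)))) \<longlongrightarrow> ln (det (Om i \<Gamma>))) F" if i: "i < m" for i
  proof -
    have Om: "mat_tendsto (n i) (n i) (\<lambda>k. Om i (g k)) (Om i \<Gamma>) F"
      unfolding Omega_def using Z[OF i] pd_matsD(1)[OF \<Lambda>[OF i]]
      by (intro mat_tendsto_add mat_tendsto_mult[where m = q] g mat_tendsto_const) auto
    have r: "vec_tendsto (n i) (\<lambda>k. resid i (b k)) (resid i \<beta>) F"
      by (intro vec_tendsto_diff mat_tendsto_mult_vec[OF _ b] mat_tendsto_const vec_tendsto_const X[OF i] Y[OF i])
    have det0: "det (Om i \<Gamma>) \<noteq> 0"
      using pd_det_pos[OF Om_pd[OF i psd(2)]] by simp
    have det: "((\<lambda>k. det (Om i (g k))) \<longlongrightarrow> det (Om i \<Gamma>)) F"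
      by (rule tendsto_det[OF Om])
    have form_eq: "form i \<beta> G = resid i \<beta> \<bullet> (adj_mat (Om i G) *\<^sub>v resid i \<beta>) / det (Om i G)"
      if "\<beta> \<in> carrier_vec p" "G \<in> psd_mats q" for \<beta> G
    proof -
      note pd = Om_pd[OF i that(2)]
      have "inv_mat (Om i G) *\<^sub>v resid i \<beta> = (1 / det (Om i G)) \<cdot>\<^sub>v (adj_mat (Om i G) *\<^sub>v resid i \<beta>)"
        unfolding pd_inverse(4)[OF pd]
        by (rule smult_mat_mult_vec[OF adj_mat(1)[OF pd_matsD(1)[OF pd]] resid_carrier[OF i that(1)]])
      then show ?thesis
        using adj_mat(1)[OF pd_matsD(1)[OF pd]] resid_carrier[OF i that(1)]
        by (simp add: scalar_prod_smult_distrib[of _ "n i"])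
    qed
    have bc: "b k \<in> carrier_vec p" "\<beta> \<in> carrier_vec p" for k
      using b by (auto simp: vec_tendsto_def)
    show "((\<lambda>k. form i (b k) (g k)) \<longlongrightarrow> form i \<beta> \<Gamma>) F"
      unfolding form_eq[OF bc(2) psd(2)] form_eq[OF bc(1) psd(1)]
      by (intro tendsto_divide det det0 tendsto_scalar_prod[OF r] mat_tendsto_mult_vec[OF mat_tendsto_adj_mat[OF Om] r])
    show "((\<lambda>k. ln (det (Om i (g k)))) \<longlongrightarrow> ln (det (Om i \<Gamma>))) F"
      using det det0 by (rule tendsto_ln)
  qed
  then show ?thesis
    unfolding L_ML_def by (intro tendsto_sum tendsto_add tendsto_mult tendsto_const) auto
qed

lemma L_attains_minimum:
  "\<exists>\<beta>' \<in> carrier_vec p. \<exists>\<Gamma>' \<in> psd_mats q. \<forall>\<beta> \<in> carrier_vec p. \<forall>\<Gamma> \<in> psd_mats q. L \<beta>' \<Gamma>' \<le> L \<beta> \<Gamma>"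
proof -
  define V where "V = {L \<beta> \<Gamma> |\<beta> \<Gamma>. \<beta> \<in> carrier_vec p \<and> \<Gamma> \<in> psd_mats q}"
  have "L (0\<^sub>v p) (0\<^sub>m q q) \<in> V"
    unfolding V_def using zero_mem_psd_mats[of q] zero_carrier_vec[of p] by blast
  then have "V \<noteq> {}" by blast
  have bdd: "bdd_below V"
    unfolding V_def by (rule bdd_belowI[where m = "(\<Sum>i<m. ln (det (\<Lambda> i))) / 2"]) (use L_lower_bound in blast)
  \<comment> \<open>The threshold \<open>Inf V + 1\<close> lies above all the tolerances
    \<open>Inf V + inverse (real (Suc k))\<close>, so \<open>C\<close> does not depend on k.\<close>
  obtain C where C: "\<And>\<beta> \<Gamma>. \<beta> \<in> carrier_vec p \<Longrightarrow> \<Gamma> \<in> psd_mats q \<Longrightarrow> L \<beta> \<Gamma> \<le> Inf V + 1 \<Longrightarrow>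
    \<exists>\<beta>' \<in> carrier_vec p. \<exists>\<Gamma>' \<in> psd_mats q. L \<beta>' \<Gamma>' = L \<beta> \<Gamma> \<and>
      (\<forall>l<p. \<bar>\<beta>' $ l\<bar> \<le> C) \<and> (\<forall>a<q. \<forall>b<q. \<bar>\<Gamma>' $$ (a, b)\<bar> \<le> C)"
    using sublevel_bounded_representative[of "Inf V + 1" thesis] by blast
  have "\<exists>\<beta> \<Gamma>. \<beta> \<in> carrier_vec p \<and> \<Gamma> \<in> psd_mats q \<and> L \<beta> \<Gamma> \<le> Inf V + inverse (real (Suc k)) \<and>
      (\<forall>l<p. \<bar>\<beta> $ l\<bar> \<le> C) \<and> (\<forall>a<q. \<forall>b<q. \<bar>\<Gamma> $$ (a, b)\<bar> \<le> C)" for k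
  proof -
    have "Inf V < Inf V + inverse (real (Suc k))"
      by simp
    then obtain \<beta> \<Gamma> where *: "\<beta> \<in> carrier_vec p" "\<Gamma> \<in> psd_mats q" "L \<beta> \<Gamma> < Inf V + inverse (real (Suc k))"
      using \<open>V \<noteq> {}\<close> bdd by (subst (asm) cInf_less_iff) (auto simp: V_def)
    moreover have "inverse (real (Suc k)) \<le> 1"
      by (simp add: inverse_le_1_iff)
    ultimately have "L \<beta> \<Gamma> \<le> Inf V + 1" by linarith
    from C[OF *(1,2) this] *(3) show ?thesis by (metis less_imp_le)
  qed
  then obtain b g where b: "\<And>k. b k \<in> carrier_vec p" and g: "\<And>k. g k \<in> psd_mats q"
    and Lbg: "\<And>k. L (b k) (g k) \<le> Inf V + inverse (real (Suc k))"
    and bC: "\<And>k l. l < p \<Longrightarrow> \<bar>b k $ l\<bar> \<le> C"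
    and gC: "\<And>k a c. a < q \<Longrightarrow> c < q \<Longrightarrow> \<bar>g k $$ (a, c)\<bar> \<le> C"
    by metis
  \<comment> \<open>Vector and matrix entries are merged into one finite family, so that a single
    subsequence serves both.\<close>
  define I where "I = {..<p} <+> {..<q} \<times> {..<q}"
  define a where "a k i = (case i of Inl j \<Rightarrow> b k $ j | Inr e \<Rightarrow> g k $$ e)" for k i
  have "finite I"
    by (simp add: I_def)
  moreover have "\<bar>a k i\<bar> \<le> C" if "i \<in> I" for k i
    using that unfolding I_def
  proof (elim PlusE)
    fix j assume "j \<in> {..<p}" "i = Inl j"
    then show ?thesis using bC[of j k] by (simp add: a_def)
  next
    fix e assume "e \<in> {..<q} \<times> {..<q}" "i = Inr e"
    then show ?thesis using gC[of "fst e" "snd e" k] by (auto simp: a_def)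
  qed
  ultimately have "\<exists>r l. strict_mono r \<and> (\<forall>i\<in>I. (\<lambda>k. a (r k) i) \<longlonglongrightarrow> l i)"
    by (rule bounded_family_convergent_subseq)
  then obtain r l where r: "strict_mono r"
    and lim: "\<And>i. i \<in> I \<Longrightarrow> (\<lambda>k. a (r k) i) \<longlonglongrightarrow> l i"
    by blast
  define \<beta>' \<Gamma>' where "\<beta>' = vec p (\<lambda>j. l (Inl j))" and "\<Gamma>' = mat q q (\<lambda>e. l (Inr e))"
  have \<beta>': "\<beta>' \<in> carrier_vec p" and \<Gamma>'c: "\<Gamma>' \<in> carrier_mat q q"
    by (simp_all add: \<beta>'_def \<Gamma>'_def)
  have "(\<lambda>k. b (r k) $ j) \<longlonglongrightarrow> \<beta>' $ j" if "j < p" for j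
    using lim[of "Inl j"] that by (simp add: \<beta>'_def I_def a_def InlI)
  then have b': "vec_tendsto p (\<lambda>k. b (r k)) \<beta>' sequentially"
    using b \<beta>' by (simp add: vec_tendsto_def)
  have "(\<lambda>k. g (r k) $$ (i, j)) \<longlonglongrightarrow> \<Gamma>' $$ (i, j)" if "i < q" "j < q" for i j
    using lim[of "Inr (i, j)"] that by (simp add: \<Gamma>'_def I_def a_def InrI)
  then have g': "mat_tendsto q q (\<lambda>k. g (r k)) \<Gamma>' sequentially"
    using psd_matsD(1)[OF g] \<Gamma>'c by (simp add: mat_tendsto_def)
  have \<Gamma>': "\<Gamma>' \<in> psd_mats q"
    by (rule psd_mats_closed[OF g g'])
  have "L \<beta>' \<Gamma>' \<le> Inf V"
  proof (rule LIMSEQ_le)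
    show "(\<lambda>k. L (b (r k)) (g (r k))) \<longlonglongrightarrow> L \<beta>' \<Gamma>'"
      by (rule tendsto_L[OF b' g' g \<Gamma>'])
    show "(\<lambda>k. Inf V + inverse (real (Suc (r k)))) \<longlonglongrightarrow> Inf V"
      using LIMSEQ_subseq_LIMSEQ[OF LIMSEQ_inverse_real_of_nat_add[of "Inf V"] r] by (simp add: o_def)
  qed (use Lbg in auto)
  moreover have "Inf V \<le> L \<beta> \<Gamma>" if "\<beta> \<in> carrier_vec p" "\<Gamma> \<in> psd_mats q" for \<beta> \<Gamma>
    using that bdd by (intro cInf_lower) (auto simp: V_def)
  ultimately show ?thesis
    using \<beta>' \<Gamma>' by (meson order_trans)
qed

end

theorem theorem1:
  fixes m p q :: nat and n :: "nat \<Rightarrow> nat"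
    and X Z \<Lambda> :: "nat \<Rightarrow> real mat" and Y :: "nat \<Rightarrow> real Matrix.vec"
  assumes "m \<ge> 1" and "p \<ge> 1" and "q \<ge> 1"
    and "\<And>i. i < m \<Longrightarrow> n i \<ge> 1"
    and "\<And>i. i < m \<Longrightarrow> X i \<in> carrier_mat (n i) p"
    and "\<And>i. i < m \<Longrightarrow> Z i \<in> carrier_mat (n i) q"
    and "\<And>i. i < m \<Longrightarrow> Y i \<in> carrier_vec (n i)"
    and "\<And>i. i < m \<Longrightarrow> \<Lambda> i \<in> pd_mats (n i)"
  shows "\<exists>\<beta>' \<in> carrier_vec p. \<exists>\<Gamma>' \<in> psd_mats q.
           \<forall>\<beta> \<in> carrier_vec p. \<forall>\<Gamma> \<in> psd_mats q.
             L_ML m X Z Y \<Lambda> \<beta>' \<Gamma>' \<le> L_ML m X Z Y \<Lambda> \<beta> \<Gamma>"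
proof -
  interpret mixed_model m p q n X Z \<Lambda> Y
    by unfold_locales (use assms in auto)
  show ?thesis
    by (rule L_attains_minimum)
qed

end
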